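(* Let $n,k\ge 2$ with $k$ even, and let $G$ be a $k$-uniform hypergraph with vertex set $[n]$. Let $\mathbf{x}$ be a least eigenvector of $G$. If $\emptyset\ne I\subset[n]$ is a proper subset, then $$\lambda(G)\ \le\ \lambda(G-I)\ \le\ \lambda(G)\Bigl(1-k\sum_{i\in I}x_i^k\Bigr)+k\sum_{j=2}^{k}\ \sum_{e\in E(G):\,|e\cap I|=j}(j-1)\mathbf{x}^e.$$ Moreover, if $\sum_{i\in [n]\setminus I}x_i^k\ne 0$, then $$\lambda(G-I)\ \le\ \frac{\lambda(G)\Bigl(1-k\sum_{i\in I}x_i^k\Bigr)+k\sum_{j=2}^{k}\ \sum_{e\in E(G):\,|e\cap I|=j}(j-1)\mathbf{x}^e}{\sum_{i\in [n]\setminus I}x_i^k}.$$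
   Context: $[n]=\{1,\dots,n\}$. A $k$-uniform hypergraph $G$ has vertex set $V(G)$ and edge set $E(G)$ consisting of $k$-element subsets of $V(G)$. Its adjacency tensor $\mathcal{A}(G)=(a_{i_1\dots i_k})$ has order $k$ and dimension $|V(G)|$, with $a_{i_1\dots i_k}=\frac{1}{(k-1)!}$ if $\{i_1,\dots,i_k\}\in E(G)$ and $0$ otherwise. For a vector $\mathbf{x}$ indexed by $V(G)$ and $U\subseteq V(G)$, $\mathbf{x}^U=\prod_{w\in U}x_w$. A real number $\lambda$ is an H-eigenvalue of $\mathcal{A}(G)$ with H-eigenvector $\mathbf{x}$ (a nonzero real vector) if $\lambda x_u^{k-1}=\sum_{e\in E(G),\,u\in e}\mathbf{x}^{e\setminus\{u\}}$ for all $u\in V(G)$. $\lambda(G)$ denotes the least H-eigenvalue of $\mathcal{A}(G)$. A least eigenvector of $G$ is a real vector $\mathbf{x}$ with $\sum_i|x_i|^k=1$ that is an eigenvector of $\mathcal{A}(G)$ associated with $\lambda(G)$. $G-I$ is the hypergraph with vertex set $V(G)\setminus I$ whose edges are the edges of $G$ disjoint from $I$. *)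

theory Defs
  imports "HOL-Analysis.Analysis" "HOL-Combinatorics.Multiset_Permutations"
begin

record 'a hypergraph =
  verts :: "'a set"
  edges :: "'a set set"

definition k_uniform :: "nat \<Rightarrow> 'a hypergraph \<Rightarrow> bool" where
  "k_uniform k G \<longleftrightarrow>
     finite (verts G) \<and> (\<forall>e\<in>edges G. e \<subseteq> verts G \<and> card e = k)"

text \<open>Vectors indexed by \<open>verts G\<close> are functions \<open>'a \<Rightarrow> real\<close>; only their
  values on \<open>verts G\<close> are ever used. The order \<open>k\<close> of the tensor is an explicit
  parameter, since it cannot be read off from a hypergraph without edges.\<close>

text \<open>The entries of the adjacency tensor are indexed by lists of length \<open>k\<close> over
  \<open>verts G\<close>.\<close>

definition adjacency_tensor :: "nat \<Rightarrow> 'a hypergraph \<Rightarrow> 'a list \<Rightarrow> real" where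
  "adjacency_tensor k G is = (if set is \<in> edges G then 1 / fact (k - 1) else 0)"

definition H_eigenpair :: "nat \<Rightarrow> 'a hypergraph \<Rightarrow> real \<Rightarrow> ('a \<Rightarrow> real) \<Rightarrow> bool" where
  "H_eigenpair k G l x \<longleftrightarrow>
     (\<exists>v\<in>verts G. x v \<noteq> 0) \<and>
     (\<forall>u\<in>verts G. l * x u ^ (k - 1) = (\<Sum>e\<in>{e \<in> edges G. u \<in> e}. \<Prod>w\<in>e - {u}. x w))"

definition H_eigenvalue :: "nat \<Rightarrow> 'a hypergraph \<Rightarrow> real \<Rightarrow> bool" where
  "H_eigenvalue k G l \<longleftrightarrow> (\<exists>x. H_eigenpair k G l x)"

definition least_H_eigenvalue :: "nat \<Rightarrow> 'a hypergraph \<Rightarrow> real" where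
  "least_H_eigenvalue k G = (LEAST l. H_eigenvalue k G l)"

definition least_eigenvector :: "nat \<Rightarrow> 'a hypergraph \<Rightarrow> ('a \<Rightarrow> real) \<Rightarrow> bool" where
  "least_eigenvector k G x \<longleftrightarrow>
     (\<Sum>i\<in>verts G. \<bar>x i\<bar> ^ k) = 1 \<and> H_eigenpair k G (least_H_eigenvalue k G) x"

definition delete_verts :: "'a hypergraph \<Rightarrow> 'a set \<Rightarrow> 'a hypergraph" where
  "delete_verts G I = \<lparr>verts = verts G - I, edges = {e \<in> edges G. e \<inter> I = {}}\<rparr>"

text \<open>The edge sum in the definition of \<open>H_eigenpair\<close> is the \<open>u\<close>-th entry of the
  tensor-vector product of the adjacency tensor with \<open>x\<close>, so eigenpairs in the above
  sense are the H-eigenpairs of the adjacency tensor.\<close>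

lemma adjacency_tensor_apply:
  assumes "k_uniform k G" and "k \<ge> 1" and "u \<in> verts G"
  shows "(\<Sum>is\<in>{is. length is = k - 1 \<and> set is \<subseteq> verts G}.
            adjacency_tensor k G (u # is) * (\<Prod>i\<leftarrow>is. x i))
         = (\<Sum>e\<in>{e \<in> edges G. u \<in> e}. \<Prod>w\<in>e - {u}. x w)"
proof -
  let ?L = "{is. length is = k - 1 \<and> set is \<subseteq> verts G}"
  let ?E = "{e \<in> edges G. u \<in> e}"
  let ?P = "\<lambda>e. permutations_of_set (e - {u})"
  let ?f = "\<lambda>is. adjacency_tensor k G (u # is) * (\<Prod>i\<leftarrow>is. x i)"
  have fin: "finite (verts G)" and sub: "\<And>e. e \<in> edges G \<Longrightarrow> e \<subseteq> verts G"
    and crd: "\<And>e. e \<in> edges G \<Longrightarrow> card e = k"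
    using assms(1) by (auto simp: k_uniform_def)
  have finL: "finite ?L"
    using finite_lists_length_eq[OF fin, of "k - 1"] by (simp add: conj_commute)
  have finE: "finite ?E"
    by (rule finite_subset[of _ "Pow (verts G)"]) (use sub fin in auto)
  have fe: "finite e" if "e \<in> edges G" for e
    using sub[OF that] fin by (rule finite_subset)
  have PL: "(\<Union>e\<in>?E. ?P e) \<subseteq> ?L"
  proof
    fix xs assume "xs \<in> (\<Union>e\<in>?E. ?P e)"
    then obtain e where e: "e \<in> edges G" "u \<in> e" and xs: "set xs = e - {u}" "distinct xs"
      by (auto simp: permutations_of_set_def)
    have "length xs = card (e - {u})"
      using distinct_card[OF xs(2)] xs(1) by simp
    also have "\<dots> = k - 1"
      using e crd[OF e(1)] fe[OF e(1)] by simp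
    finally show "xs \<in> ?L"
      using xs(1) sub[OF e(1)] by blast
  qed
  have zero: "?f is = 0" if "is \<in> ?L - (\<Union>e\<in>?E. ?P e)" for "is"
  proof (rule ccontr)
    assume "?f is \<noteq> 0"
    then have e: "insert u (set is) \<in> edges G"
      by (cases "insert u (set is) \<in> edges G") (simp_all add: adjacency_tensor_def)
    have len: "length is = k - 1"
      using that by simp
    have "card (set (u # is)) = length (u # is)"
      using crd[OF e] len assms(2) by simp
    then have "distinct (u # is)"
      by (rule card_distinct)
    then have "is \<in> ?P (insert u (set is))"
      by (simp add: permutations_of_set_def)
    moreover have "insert u (set is) \<in> ?E"
      using e by simp
    ultimately have "is \<in> (\<Union>e\<in>?E. ?P e)"
      by (rule UN_I[rotated])
    then show False
      using that by (rule DiffD2[rotated])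
  qed
  have disj: "\<forall>e\<in>?E. \<forall>e'\<in>?E. e \<noteq> e' \<longrightarrow> ?P e \<inter> ?P e' = {}"
  proof (intro ballI impI)
    fix e e' assume "e \<in> ?E" "e' \<in> ?E" and "e \<noteq> e'"
    then have "e - {u} \<noteq> e' - {u}"
      by blast
    then show "?P e \<inter> ?P e' = {}"
      by (auto simp: permutations_of_set_def)
  qed
  have inner: "(\<Sum>is\<in>?P e. ?f is) = (\<Prod>w\<in>e - {u}. x w)" if "e \<in> ?E" for e
  proof -
    have "?f is = (\<Prod>w\<in>e - {u}. x w) / fact (k - 1)" if "is \<in> ?P e" for "is"
    proof -
      have s: "set is = e - {u}" "distinct is"
        using that by (auto simp: permutations_of_set_def)
      then have "insert u (set is) = e"
        using \<open>e \<in> ?E\<close> by auto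
      then show ?thesis
        using \<open>e \<in> ?E\<close> prod.distinct_set_conv_list[OF s(2), of x] s(1)
        by (simp add: adjacency_tensor_def)
    qed
    moreover have "card (?P e) = fact (k - 1)"
      using that fe crd by simp
    ultimately show ?thesis
      by simp
  qed
  have "(\<Sum>is\<in>?L. ?f is) = (\<Sum>is\<in>(\<Union>e\<in>?E. ?P e). ?f is)"
    by (rule sum.mono_neutral_right[OF finL PL]) (rule ballI, rule zero)
  also have "\<dots> = (\<Sum>e\<in>?E. \<Sum>is\<in>?P e. ?f is)"
    by (rule sum.UNION_disjoint[OF finE _ disj]) (intro ballI finite_permutations_of_set)
  also have "\<dots> = (\<Sum>e\<in>?E. \<Prod>w\<in>e - {u}. x w)"
    by (rule sum.cong[OF refl inner])
  finally show ?thesis .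
qed

end

theory Submission
  imports Defs
begin

text \<open>
  For even \<open>k\<close> and a nonempty vertex set the least H-eigenvalue has a variational description: it
  is the minimum of the form \<open>P(x) = k * (\<Sum>e. x\<^sup>e)\<close> on the compact set where
  \<open>N(x) = (\<Sum>i. x\<^sub>i ^ k)\<close> equals \<open>1\<close>, so \<open>\<lambda>(G) * N(x) \<le> P(x)\<close> for all \<open>x\<close>
  (\<open>least_H_eigenvalue_variational\<close>). All three inequalities follow by inserting a suitable
  vector into this description.

  For \<open>\<lambda>(G) \<le> \<lambda>(G - I)\<close>, a minimising eigenvector of \<open>G - I\<close> extended by zero on \<open>I\<close> has
  the same value of \<open>P\<close> and of \<open>N\<close> in \<open>G\<close>, because every edge that meets \<open>I\<close> contributes
  zero (\<open>least_H_eigenvalue_delete_verts_ge\<close>).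

  For the upper bounds, a least eigenvector \<open>x\<close> of \<open>G\<close> is restricted to the complement of \<open>I\<close>.
  Multiplying the eigenvalue equation at \<open>i\<close> by \<open>x\<^sub>i\<close> and summing over \<open>i \<in> I\<close> counts
  each edge \<open>e\<close> with weight \<open>|e \<inter> I|\<close> (\<open>weighted_euler_identity\<close>); hence the edges disjoint
  from \<open>I\<close> contribute exactly the right-hand side \<open>R\<close> of the claim (\<open>edge_form_delete_verts\<close>), and
  \<open>\<lambda>(G - I) * S \<le> R\<close> with \<open>S = (\<Sum>i\<notin>I. x\<^sub>i ^ k)\<close>. Dividing by \<open>S\<close> gives the
  sharper bound. The bound without the denominator follows since \<open>S \<le> 1\<close> and
  \<open>\<lambda>(G - I) \<le> 0\<close> (\<open>least_H_eigenvalue_nonpos\<close>).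
\<close>

section \<open>The edge form and the power sum\<close>

text \<open>The value \<open>\<A> x\<^sup>k\<close> of the adjacency tensor, as a form of degree \<open>k\<close>: each edge
  appears \<open>k!\<close> times with coefficient \<open>1 / (k - 1)!\<close>, which leaves the factor \<open>k\<close>.\<close>

definition edge_form :: "nat \<Rightarrow> 'a hypergraph \<Rightarrow> ('a \<Rightarrow> real) \<Rightarrow> real" where
  "edge_form k G x = real k * (\<Sum>e\<in>edges G. \<Prod>w\<in>e. x w)"

definition power_form :: "nat \<Rightarrow> 'a hypergraph \<Rightarrow> ('a \<Rightarrow> real) \<Rightarrow> real" where
  "power_form k G x = (\<Sum>i\<in>verts G. x i ^ k)"

lemma k_uniformD:
  assumes "k_uniform k G"
  shows "finite (verts G)" and "finite (edges G)"
    and "\<And>e. e \<in> edges G \<Longrightarrow> e \<subseteq> verts G" and "\<And>e. e \<in> edges G \<Longrightarrow> card e = k"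
    and "\<And>e. e \<in> edges G \<Longrightarrow> finite e"
proof -
  show fin: "finite (verts G)"
    using assms by (simp add: k_uniform_def)
  show sub: "e \<subseteq> verts G" if "e \<in> edges G" for e
    using assms that by (simp add: k_uniform_def)
  show "card e = k" if "e \<in> edges G" for e
    using assms that by (simp add: k_uniform_def)
  show "finite (edges G)"
    by (rule finite_subset[of _ "Pow (verts G)"]) (use sub fin in auto)
  show "finite e" if "e \<in> edges G" for e
    using sub[OF that] fin by (rule finite_subset)
qed

lemma k_uniform_delete_verts:
  "k_uniform k G \<Longrightarrow> k_uniform k (delete_verts G I)"
  by (auto simp: k_uniform_def delete_verts_def)

lemma power_form_pos:
  assumes "finite (verts G)" and "even k" and "v \<in> verts G" and "x v \<noteq> 0"
  shows "power_form k G x > 0"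
  unfolding power_form_def using assms
  by (intro sum_pos2[of _ v]) (auto simp: zero_less_power_eq)

text \<open>Multiplying the eigenvalue equation at \<open>i\<close> by \<open>x\<^sub>i\<close> completes each product to \<open>x\<^sup>e\<close>.
  On summing over \<open>U\<close>, an edge is then reached once from each of its vertices in \<open>U\<close>.\<close>

lemma weighted_euler_identity:
  assumes G: "k_uniform k G" and "k > 0" and ev: "H_eigenpair k G l x" and U: "U \<subseteq> verts G"
  shows "l * (\<Sum>i\<in>U. x i ^ k) = (\<Sum>e\<in>edges G. real (card (e \<inter> U)) * (\<Prod>w\<in>e. x w))"
proof -
  have finU: "finite U"
    using k_uniformD(1)[OF G] U by (rule finite_subset[rotated])
  have "l * x i ^ k = (\<Sum>e | e \<in> edges G \<and> i \<in> e. \<Prod>w\<in>e. x w)" if "i \<in> U" for i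
  proof -
    have "l * x i ^ k = x i * (l * x i ^ (k - 1))"
      using \<open>k > 0\<close> by (simp add: power_eq_if)
    also have "\<dots> = (\<Sum>e | e \<in> edges G \<and> i \<in> e. x i * (\<Prod>w\<in>e - {i}. x w))"
      using ev U that by (auto simp: H_eigenpair_def sum_distrib_left)
    also have "\<dots> = (\<Sum>e | e \<in> edges G \<and> i \<in> e. \<Prod>w\<in>e. x w)"
      using k_uniformD(5)[OF G] by (intro sum.cong) (auto simp flip: prod.remove)
    finally show ?thesis .
  qed
  then have "l * (\<Sum>i\<in>U. x i ^ k) = (\<Sum>i\<in>U. \<Sum>e | e \<in> edges G \<and> i \<in> e. \<Prod>w\<in>e. x w)"
    by (simp add: sum_distrib_left)
  also have "\<dots> = (\<Sum>e\<in>edges G. \<Sum>i | i \<in> U \<and> i \<in> e. \<Prod>w\<in>e. x w)"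
    by (rule sum.swap_restrict[OF finU k_uniformD(2)[OF G]])
  also have "\<dots> = (\<Sum>e\<in>edges G. real (card (e \<inter> U)) * (\<Prod>w\<in>e. x w))"
    by (simp add: Int_def conj_commute)
  finally show ?thesis .
qed

text \<open>For \<open>U\<close> the whole vertex set all weights equal \<open>k\<close>, which makes each eigenvalue the value of a
  Rayleigh-type quotient.\<close>

lemma eigenpair_forms:
  assumes G: "k_uniform k G" and "k > 0" and "H_eigenpair k G l x"
  shows "l * power_form k G x = edge_form k G x"
proof -
  have "real (card (e \<inter> verts G)) = real k" if "e \<in> edges G" for e
    using k_uniformD(3,4)[OF G that] by (simp add: Int_absorb2)
  then show ?thesis
    using weighted_euler_identity[OF assms order_refl]
    by (simp add: power_form_def edge_form_def sum_distrib_left)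
qed

lemma forms_scale:
  assumes G: "k_uniform k G"
  shows "edge_form k G (\<lambda>i. c * x i) = c ^ k * edge_form k G x"
    and "power_form k G (\<lambda>i. c * x i) = c ^ k * power_form k G x"
proof -
  have "(\<Prod>w\<in>e. c * x w) = c ^ k * (\<Prod>w\<in>e. x w)" if "e \<in> edges G" for e
    using k_uniformD(4)[OF G that] by (simp add: prod.distrib)
  then show "edge_form k G (\<lambda>i. c * x i) = c ^ k * edge_form k G x"
    by (simp add: edge_form_def sum_distrib_left mult_ac)
  show "power_form k G (\<lambda>i. c * x i) = c ^ k * power_form k G x"
    by (simp add: power_form_def sum_distrib_left power_mult_distrib)
qed

lemma forms_cong:
  assumes "k_uniform k G" and "\<And>i. i \<in> verts G \<Longrightarrow> x i = y i"
  shows "edge_form k G x = edge_form k G y" and "power_form k G x = power_form k G y"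
  using assms k_uniformD(3)[OF assms(1)]
  by (auto simp: edge_form_def power_form_def intro!: sum.cong prod.cong)

section \<open>Variational characterisation of the least H-eigenvalue\<close>

text \<open>Since \<open>k\<close> is even, a power sum equal to \<open>1\<close> confines every coordinate to \<open>[-1, 1]\<close>, so
  the constraint set is compact by the theorem of Tychonoff. Coordinates outside the vertex set do
  not influence either form; fixing them to \<open>0\<close> keeps the set compact in the product topology
  on all functions.\<close>

lemma edge_form_attains_min:
  assumes G: "k_uniform k G" and ne: "verts G \<noteq> {}" and k: "even k" "k > 0"
  obtains y where "power_form k G y = 1"
    and "\<And>x. power_form k G x = 1 \<Longrightarrow> edge_form k G y \<le> edge_form k G x"
proof -
  let ?B = "\<lambda>i. if i \<in> verts G then {-1..1} else {0::real}"
  let ?K = "(\<Pi>\<^sub>E i\<in>UNIV. ?B i) \<inter> {x. power_form k G x = 1}"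
  have fin: "finite (verts G)" by (rule k_uniformD(1)[OF G])
  have "compactin (product_topology (\<lambda>i. euclidean) UNIV) (\<Pi>\<^sub>E i\<in>UNIV. ?B i)"
    by (subst compactin_PiE) auto
  then have cpt: "compact (\<Pi>\<^sub>E i\<in>UNIV. ?B i)"
    by (simp add: euclidean_product_topology)
  have contN: "continuous_on UNIV (power_form k G)"
    unfolding power_form_def
    by (intro continuous_intros continuous_on_product_coordinates)
  have contE: "continuous_on UNIV (edge_form k G)"
    unfolding edge_form_def
    by (intro continuous_intros continuous_on_product_coordinates)
  have "closed {x. power_form k G x = 1}"
    by (intro closed_Collect_eq contN continuous_on_const)
  with cpt have cptK: "compact ?K" by blast
  have rep: "\<exists>z\<in>?K. edge_form k G z = edge_form k G x" if x: "power_form k G x = 1" for x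
  proof -
    let ?z = "\<lambda>i. if i \<in> verts G then x i else 0"
    have "\<bar>x i\<bar> \<le> 1" if "i \<in> verts G" for i
    proof -
      have "x i ^ k \<le> 1"
        using member_le_sum[of i "verts G" "\<lambda>i. x i ^ k"] that fin k x
        by (auto simp: power_form_def zero_le_even_power)
      then have "\<bar>x i\<bar> ^ k \<le> 1" using k by (simp add: power_even_abs)
      then show ?thesis using k by (simp add: power_le_one_iff)
    qed
    then have "?z \<in> (\<Pi>\<^sub>E i\<in>UNIV. ?B i)" by (fastforce simp: abs_le_iff)
    moreover have "power_form k G ?z = 1" "edge_form k G ?z = edge_form k G x"
      using forms_cong[OF G, of ?z x] x by simp_all
    ultimately show ?thesis by blast
  qed
  obtain v where v: "v \<in> verts G" using ne by blast
  have "power_form k G (\<lambda>i. if i = v then 1 else 0) = 1"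
    using v fin k by (simp add: power_form_def if_distrib[of "\<lambda>t. t ^ k"] zero_power cong: if_cong)
  from rep[OF this] have "?K \<noteq> {}" by blast
  from continuous_attains_inf[OF cptK this continuous_on_subset[OF contE]]
  obtain y where y: "y \<in> ?K" "\<And>z. z \<in> ?K \<Longrightarrow> edge_form k G y \<le> edge_form k G z" by blast
  show thesis
  proof (rule that)
    show "power_form k G y = 1" using y(1) by blast
    show "edge_form k G y \<le> edge_form k G x" if "power_form k G x = 1" for x
      using rep[OF that] y(2) by metis
  qed
qed

text \<open>Write \<open>P\<close> for the edge form and \<open>N\<close> for the power sum. By homogeneity the minimum \<open>m\<close> of
  \<open>P\<close> on \<open>N = 1\<close> gives \<open>P - m * N \<ge> 0\<close> everywhere, with equality at the minimiser \<open>y\<close>. So all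
  partial derivatives of \<open>P - m * N\<close> vanish at \<open>y\<close>, and these equations are precisely the
  eigenvalue equations for \<open>m\<close>. Conversely, every eigenvalue is a value of \<open>P / N\<close>, hence at
  least \<open>m\<close>.\<close>

lemma least_H_eigenvalue_variational:
  assumes G: "k_uniform k G" and ne: "verts G \<noteq> {}" and k: "even k" "k > 0"
  shows "H_eigenvalue k G (least_H_eigenvalue k G)"
    and "least_H_eigenvalue k G * power_form k G x \<le> edge_form k G x"
proof -
  obtain y where y: "power_form k G y = 1"
    and min: "\<And>x. power_form k G x = 1 \<Longrightarrow> edge_form k G y \<le> edge_form k G x"
    using edge_form_attains_min[OF assms] by blast
  define m where "m = edge_form k G y"
  have fin: "finite (verts G)" and finE: "finite (edges G)"
    by (rule k_uniformD[OF G])+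
  have bound: "m * power_form k G x \<le> edge_form k G x" for x
  proof (cases "\<exists>v\<in>verts G. x v \<noteq> 0")
    case True
    let ?s = "power_form k G x"
    have s: "?s > 0" using power_form_pos[OF fin k(1)] True by blast
    define c where "c = 1 / root k ?s"
    have ck: "c ^ k = 1 / ?s" using s k by (simp add: c_def power_divide)
    have "m \<le> edge_form k G (\<lambda>i. c * x i)"
      unfolding m_def using s by (intro min) (simp add: forms_scale[OF G] ck)
    then show ?thesis
      using s by (simp add: forms_scale[OF G] ck field_simps)
  next
    case False
    then have "edge_form k G x = edge_form k G (\<lambda>i. 0 * x i)"
      and "power_form k G x = power_form k G (\<lambda>i. 0 * x i)"
      using forms_cong[OF G, of x "\<lambda>i. 0 * x i"] by simp_all
    then have "edge_form k G x = 0" and "power_form k G x = 0"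
      using forms_scale[OF G, of 0 x] k by (simp_all add: zero_power)
    then show ?thesis by simp
  qed
  have "H_eigenpair k G m y"
    unfolding H_eigenpair_def
  proof (intro conjI ballI)
    show "\<exists>v\<in>verts G. y v \<noteq> 0"
    proof (rule ccontr)
      assume "\<not> ?thesis"
      then have "power_form k G y = 0" using k by (simp add: power_form_def zero_power)
      with y show False by simp
    qed
  next
    fix u assume u: "u \<in> verts G"
    let ?S = "\<Sum>e | e \<in> edges G \<and> u \<in> e. \<Prod>w\<in>e - {u}. y w"
    let ?g = "\<lambda>t. edge_form k G (y(u := t)) - m * power_form k G (y(u := t))"
    define a where "a = (\<Sum>e | e \<in> edges G \<and> u \<notin> e. \<Prod>w\<in>e. y w)"
    define b where "b = (\<Sum>i\<in>verts G - {u}. y i ^ k)"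
    \<comment> \<open>In the single variable \<open>t\<close> the edge form is affine with slope \<open>k * ?S\<close>, because an edge
      contains \<open>u\<close> at most once.\<close>
    have prodS: "(\<Sum>e\<in>edges G. \<Prod>w\<in>e. (y(u := t)) w) = t * ?S + a" for t
    proof -
      have "(\<Sum>e\<in>edges G. \<Prod>w\<in>e. (y(u := t)) w) =
        (\<Sum>e\<in>edges G. if u \<in> e then t * (\<Prod>w\<in>e - {u}. y w) else (\<Prod>w\<in>e. y w))"
      proof (rule sum.cong[OF refl])
        fix e assume e: "e \<in> edges G"
        have "(\<Prod>w\<in>e - {u}. (y(u := t)) w) = (\<Prod>w\<in>e - {u}. y w)"
          by (rule prod.cong) auto
        moreover have "(\<Prod>w\<in>e. (y(u := t)) w) = (\<Prod>w\<in>e. y w)" if "u \<notin> e"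
          using that by (intro prod.cong) auto
        ultimately show "(\<Prod>w\<in>e. (y(u := t)) w) =
          (if u \<in> e then t * (\<Prod>w\<in>e - {u}. y w) else (\<Prod>w\<in>e. y w))"
          using prod.remove[OF k_uniformD(5)[OF G e], of u "y(u := t)"] by simp
      qed
      also have "\<dots> = t * ?S + a"
        using finE by (simp add: sum.If_cases a_def sum_distrib_left Int_def)
      finally show ?thesis .
    qed
    have powS: "power_form k G (y(u := t)) = t ^ k + b" for t
      unfolding power_form_def b_def by (subst sum.remove[OF fin u]) simp
    have g: "?g = (\<lambda>t. real k * (t * ?S + a) - m * (t ^ k + b))"
      by (simp only: edge_form_def prodS powS)
    have "(?g has_real_derivative (real k * (?S - m * y u ^ (k - 1)))) (at (y u))"
      unfolding g by (rule derivative_eq_intros refl)+ (simp add: right_diff_distrib)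
    moreover have "?g (y u) \<le> ?g t" for t
      using bound[of "y(u := t)"] y by (simp add: m_def)
    ultimately have "real k * (?S - m * y u ^ (k - 1)) = 0"
      by (intro DERIV_local_min[where d = 1]) auto
    then have "?S - m * y u ^ (k - 1) = 0"
      using k(2) by (simp only: mult_eq_0_iff of_nat_eq_0_iff) blast
    then show "m * y u ^ (k - 1) = ?S" by linarith
  qed
  then have ev: "H_eigenvalue k G m" by (auto simp: H_eigenvalue_def)
  have least: "m \<le> l" if "H_eigenvalue k G l" for l
  proof -
    obtain x where x: "H_eigenpair k G l x" using \<open>H_eigenvalue k G l\<close> by (auto simp: H_eigenvalue_def)
    then have "power_form k G x > 0"
      using power_form_pos[OF fin k(1)] by (auto simp: H_eigenpair_def)
    moreover have "m * power_form k G x \<le> l * power_form k G x"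
      using bound[of x] eigenpair_forms[OF G k(2) x] by simp
    ultimately show ?thesis by simp
  qed
  have "least_H_eigenvalue k G = m"
    unfolding least_H_eigenvalue_def using ev least by (rule Least_equality)
  then show "H_eigenvalue k G (least_H_eigenvalue k G)"
    and "least_H_eigenvalue k G * power_form k G x \<le> edge_form k G x"
    using ev bound by simp_all
qed

section \<open>Deleting vertices\<close>

text \<open>A unit coordinate vector kills every edge, since an edge has at least two vertices; it is a test
  vector of power sum \<open>1\<close> and edge form \<open>0\<close>.\<close>

lemma least_H_eigenvalue_nonpos:
  assumes G: "k_uniform k G" and v: "v \<in> verts G" and k: "even k" "k \<ge> 2"
  shows "least_H_eigenvalue k G \<le> 0"
proof -
  let ?d = "\<lambda>i. if i = v then 1 else 0 :: real"
  have "(\<Prod>w\<in>e. ?d w) = 0" if "e \<in> edges G" for e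
  proof -
    have "\<not> e \<subseteq> {v}"
      using card_mono[of "{v}" e] k_uniformD(4)[OF G that] k by auto
    then show ?thesis using k_uniformD(5)[OF G that] by auto
  qed
  then have "edge_form k G ?d = 0" by (simp add: edge_form_def)
  moreover have "power_form k G ?d = 1"
    using v k_uniformD(1)[OF G] k
    by (simp add: power_form_def if_distrib[of "\<lambda>t. t ^ k"] zero_power cong: if_cong)
  ultimately show ?thesis
    using least_H_eigenvalue_variational(2)[OF G _ k(1), of ?d] v k by auto
qed

text \<open>Extending an eigenvector of \<open>delete_verts G I\<close> by zero preserves both forms, so it is an
  admissible test vector for \<open>G\<close>.\<close>

lemma least_H_eigenvalue_delete_verts_ge:
  assumes G: "k_uniform k G" and ne: "verts G - I \<noteq> {}" and k: "even k" "k > 0"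
  shows "least_H_eigenvalue k G \<le> least_H_eigenvalue k (delete_verts G I)"
proof -
  let ?H = "delete_verts G I"
  have H: "k_uniform k ?H" by (rule k_uniform_delete_verts[OF G])
  have neH: "verts ?H \<noteq> {}" using ne by (simp add: delete_verts_def)
  obtain y where y: "H_eigenpair k ?H (least_H_eigenvalue k ?H) y"
    using least_H_eigenvalue_variational(1)[OF H neH k] by (auto simp: H_eigenvalue_def)
  let ?z = "\<lambda>i. if i \<in> I then 0 else y i"
  have "(\<Sum>e\<in>edges G. \<Prod>w\<in>e. ?z w) = (\<Sum>e\<in>edges ?H. \<Prod>w\<in>e. y w)"
  proof (rule sum.mono_neutral_cong_right)
    show "\<forall>e\<in>edges G - edges ?H. (\<Prod>w\<in>e. ?z w) = 0"
      using k_uniformD(5)[OF G] by (auto simp: delete_verts_def)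
  qed (use k_uniformD(2)[OF G] in \<open>auto simp: delete_verts_def intro!: prod.cong\<close>)
  then have E: "edge_form k G ?z = edge_form k ?H y"
    by (simp add: edge_form_def)
  have N: "power_form k G ?z = power_form k ?H y"
    unfolding power_form_def
    by (rule sum.mono_neutral_cong_right)
      (use k_uniformD(1)[OF G] k in \<open>auto simp: delete_verts_def zero_power\<close>)
  have "least_H_eigenvalue k G * power_form k ?H y \<le> least_H_eigenvalue k ?H * power_form k ?H y"
    using least_H_eigenvalue_variational(2)[OF G _ k, of ?z] ne
    by (auto simp: E N eigenpair_forms[OF H k(2) y])
  moreover have "power_form k ?H y > 0"
    using y power_form_pos[OF k_uniformD(1)[OF H] k(1)] by (auto simp: H_eigenpair_def)
  ultimately show ?thesis by simp
qed

text \<open>With \<open>c = |e \<inter> I|\<close>, the indicator of \<open>c = 0\<close> equals \<open>1 - c + (c - 1)\<close> where the last term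
  is present only for \<open>c \<ge> 2\<close>. Summed against \<open>x\<^sup>e\<close>, the first term gives the eigenvalue, the
  second is evaluated by the weighted Euler identity on \<open>I\<close>, and the third is the
  double sum, grouped by the value \<open>j\<close> of \<open>c\<close>.\<close>

lemma edge_form_delete_verts:
  assumes G: "k_uniform k G" and "k > 0" and ev: "H_eigenpair k G l x" and I: "I \<subseteq> verts G"
    and norm: "power_form k G x = 1"
  shows "edge_form k (delete_verts G I) x =
    l * (1 - real k * (\<Sum>i\<in>I. x i ^ k)) +
    real k * (\<Sum>j=2..k. \<Sum>e | e \<in> edges G \<and> card (e \<inter> I) = j. (real j - 1) * (\<Prod>w\<in>e. x w))"
proof -
  let ?p = "\<lambda>e. \<Prod>w\<in>e. x w" and ?c = "\<lambda>e. card (e \<inter> I)"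
  let ?T = "{e \<in> edges G. 2 \<le> ?c e}"
  have finE: "finite (edges G)" by (rule k_uniformD(2)[OF G])
  have cI: "?c e \<le> k" if "e \<in> edges G" for e
    using card_mono[OF k_uniformD(5)[OF G that], of "e \<inter> I"] k_uniformD(4)[OF G that] by auto
  have c0: "?c e = 0 \<longleftrightarrow> e \<inter> I = {}" if "e \<in> edges G" for e
    using k_uniformD(5)[OF G that] by auto
  have "(\<Sum>j=2..k. \<Sum>e | e \<in> edges G \<and> ?c e = j. (real j - 1) * ?p e) =
    (\<Sum>j=2..k. \<Sum>e | e \<in> ?T \<and> ?c e = j. (real (?c e) - 1) * ?p e)"
    by (intro sum.cong) auto
  also have "\<dots> = (\<Sum>e\<in>?T. (real (?c e) - 1) * ?p e)"
    by (rule sum.group) (use finE cI in auto)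
  also have "\<dots> = (\<Sum>e\<in>edges G. if 2 \<le> ?c e then (real (?c e) - 1) * ?p e else 0)"
    using finE by (simp add: sum.inter_filter)
  finally have double: "(\<Sum>j=2..k. \<Sum>e | e \<in> edges G \<and> ?c e = j. (real j - 1) * ?p e) =
    (\<Sum>e\<in>edges G. if 2 \<le> ?c e then (real (?c e) - 1) * ?p e else 0)" .
  have "(\<Sum>e\<in>edges (delete_verts G I). ?p e) = (\<Sum>e\<in>edges G. if e \<inter> I = {} then ?p e else 0)"
    using finE by (simp add: delete_verts_def sum.inter_filter)
  also have "\<dots> = (\<Sum>e\<in>edges G. ?p e - real (?c e) * ?p e +
      (if 2 \<le> ?c e then (real (?c e) - 1) * ?p e else 0))"
  proof (rule sum.cong[OF refl])
    fix e assume "e \<in> edges G"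
    then show "(if e \<inter> I = {} then ?p e else 0) = ?p e - real (?c e) * ?p e +
      (if 2 \<le> ?c e then (real (?c e) - 1) * ?p e else 0)"
      using c0[of e]
      by (cases "?c e = 0"; cases "?c e = 1") (auto simp: algebra_simps)
  qed
  also have "\<dots> = (\<Sum>e\<in>edges G. ?p e) - (\<Sum>e\<in>edges G. real (?c e) * ?p e) +
      (\<Sum>e\<in>edges G. if 2 \<le> ?c e then (real (?c e) - 1) * ?p e else 0)"
    by (simp only: sum.distrib sum_subtractf)
  finally have "edge_form k (delete_verts G I) x = edge_form k G x - real k * (l * (\<Sum>i\<in>I. x i ^ k)) +
    real k * (\<Sum>j=2..k. \<Sum>e | e \<in> edges G \<and> ?c e = j. (real j - 1) * ?p e)"
    unfolding double weighted_euler_identity[OF G \<open>k > 0\<close> ev I] edge_form_def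
    by (simp only: distrib_left right_diff_distrib)
  also have "edge_form k G x = l"
    using eigenpair_forms[OF G \<open>k > 0\<close> ev] norm by simp
  finally show ?thesis by (simp add: algebra_simps)
qed

theorem corollary5p1:
  fixes n k :: nat and G :: "nat hypergraph" and x :: "nat \<Rightarrow> real" and I :: "nat set"
  assumes "n \<ge> 2" and "k \<ge> 2" and "even k"
    and "k_uniform k G" and "verts G = {1..n}"
    and "least_eigenvector k G x"
    and "I \<noteq> {}" and "I \<subset> {1..n}"
  shows "least_H_eigenvalue k G \<le> least_H_eigenvalue k (delete_verts G I) \<and>
         least_H_eigenvalue k (delete_verts G I) \<le>
           least_H_eigenvalue k G * (1 - real k * (\<Sum>i\<in>I. x i ^ k)) +
           real k * (\<Sum>j=2..k. \<Sum>e\<in>{e \<in> edges G. card (e \<inter> I) = j}. (real j - 1) * (\<Prod>w\<in>e. x w)) \<and>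
         ((\<Sum>i\<in>{1..n} - I. x i ^ k) \<noteq> 0 \<longrightarrow>
          least_H_eigenvalue k (delete_verts G I) \<le>
            (least_H_eigenvalue k G * (1 - real k * (\<Sum>i\<in>I. x i ^ k)) +
             real k * (\<Sum>j=2..k. \<Sum>e\<in>{e \<in> edges G. card (e \<inter> I) = j}. (real j - 1) * (\<Prod>w\<in>e. x w)))
            / (\<Sum>i\<in>{1..n} - I. x i ^ k))"
proof -
  let ?H = "delete_verts G I"
  let ?L = "least_H_eigenvalue k ?H"
  let ?S = "\<Sum>i\<in>{1..n} - I. x i ^ k"
  let ?R = "least_H_eigenvalue k G * (1 - real k * (\<Sum>i\<in>I. x i ^ k)) +
    real k * (\<Sum>j=2..k. \<Sum>e\<in>{e \<in> edges G. card (e \<inter> I) = j}. (real j - 1) * (\<Prod>w\<in>e. x w))"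
  have k: "k > 0" using \<open>k \<ge> 2\<close> by simp
  note G = \<open>k_uniform k G\<close> and V = \<open>verts G = {1..n}\<close>
  have H: "k_uniform k ?H" by (rule k_uniform_delete_verts[OF G])
  have I: "I \<subseteq> verts G" and ne: "verts G - I \<noteq> {}" using \<open>I \<subset> {1..n}\<close> V by auto
  then obtain v where v: "v \<in> verts ?H" by (auto simp: delete_verts_def)
  have ev: "H_eigenpair k G (least_H_eigenvalue k G) x" and norm: "power_form k G x = 1"
    using \<open>least_eigenvector k G x\<close> \<open>even k\<close>
    by (auto simp: least_eigenvector_def power_form_def power_even_abs)
  have S: "power_form k ?H x = ?S"
    by (simp add: power_form_def delete_verts_def V)
  have "?S \<le> (\<Sum>i\<in>{1..n}. x i ^ k)"
    using \<open>even k\<close> by (intro sum_mono2) auto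
  then have S1: "?S \<le> 1" using norm by (simp add: power_form_def V)
  have S0: "?S \<ge> 0" using \<open>even k\<close> by (intro sum_nonneg) auto
  have LS: "?L * ?S \<le> ?R"
    using least_H_eigenvalue_variational(2)[OF H _ \<open>even k\<close> k, of x] v
    unfolding S edge_form_delete_verts[OF G k ev I norm] by auto
  have "?L \<le> 0" by (rule least_H_eigenvalue_nonpos[OF H v \<open>even k\<close> \<open>k \<ge> 2\<close>])
  with S1 have "?L \<le> ?L * ?S" using mult_left_mono_neg[of ?S 1 ?L] by simp
  with LS have "?L \<le> ?R" by linarith
  moreover have "?L \<le> ?R / ?S" if "?S \<noteq> 0"
    using LS S0 that by (simp add: pos_le_divide_eq)
  ultimately show ?thesis
    using least_H_eigenvalue_delete_verts_ge[OF G ne \<open>even k\<close> k] by blast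
qed

end
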